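(* Let $G$ be a nontrivial finite abelian group, let $m\ge 1$ be an integer, and let $E: a_1x_1+\dots+a_{2m+1}x_{2m+1}=0$ be a linear equation with coefficients $a_i\in\mathbb{Z}\setminus\{0\}$ for $i=1,\dots,2m+1$, such that $|G|$ is coprime to $a_i$ for every $i=1,\dots,2m+1$. Then $E$ is $r$-uncommon over $G$ for every integer $r\ge 3$.
   Context: Let $G$ be a finite abelian group and $E: a_1x_1+\dots+a_kx_k=0$ a linear equation with nonzero integer coefficients (integers act on $G$ by repeated addition). Let $\mathcal{C}(E)=\{v\in G^k: a_1v_1+\dots+a_kv_k=0\}$. A (probabilistic) $r$-coloring of $G$ is a tuple of functions $f_1,\dots,f_r: G\to[0,1]$ with $f_1(t)+\dots+f_r(t)=1$ for every $t\in G$, where $f_j(t)$ is regarded as the probability that $t$ receives color $j$. The (expected) proportion of monochromatic solutions of $E$ in $G$ for this coloring is $$\mu_E(f_1,\dots,f_r)=\frac{1}{|\mathcal{C}(E)|}\sum_{v\in\mathcal{C}(E)}\ \sum_{j=1}^{r}\ \prod_{i=1}^{k} f_j(v_i).$$ The uniformly random coloring, $f_1=\dots=f_r=1/r$, has $\mu_E=r^{1-k}$. The equation $E$ is called $r$-common over $G$ if $\mu_E(f_1,\dots,f_r)\ge r^{1-k}$ for every $r$-coloring $(f_1,\dots,f_r)$ of $G$, and $r$-uncommon over $G$ otherwise, i.e. if some $r$-coloring $(f_1,\dots,f_r)$ satisfies $\mu_E(f_1,\dots,f_r)<r^{1-k}$. *)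

theory Defs
  imports Complex_Main "HOL-Algebra.FiniteProduct" "HOL-Algebra.Coset"
begin

text \<open>
  Abelian groups follow the multiplicative convention of HOL-Algebra, so the left-hand side
  \<open>a\<^sub>1 x\<^sub>1 + \<dots> + a\<^sub>k x\<^sub>k\<close> of an equation is written as a product of
  integer powers and \<open>0\<close> as the neutral element. An equation in \<open>k\<close> variables is given by
  \<open>k\<close> and its coefficients \<open>a i\<close>, of which only those with \<open>i \<in> {1..k}\<close> matter.
  Tuples in \<open>G\<^sup>k\<close> are extensional functions on \<open>{1..k}\<close>, so that each tuple is
  counted exactly once.
\<close>

definition solutions :: "('a, 'b) monoid_scheme \<Rightarrow> nat \<Rightarrow> (nat \<Rightarrow> int) \<Rightarrow> (nat \<Rightarrow> 'a) set"
  where "solutions G k a =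
    {v \<in> {1..k} \<rightarrow>\<^sub>E carrier G. (\<Otimes>\<^bsub>G\<^esub>i\<in>{1..k}. v i [^]\<^bsub>G\<^esub> a i) = \<one>\<^bsub>G\<^esub>}"

text \<open>The values of \<open>f j\<close> off the carrier and for \<open>j \<notin> {1..r}\<close> are irrelevant.\<close>

definition coloring :: "('a, 'b) monoid_scheme \<Rightarrow> nat \<Rightarrow> (nat \<Rightarrow> 'a \<Rightarrow> real) \<Rightarrow> bool"
  where "coloring G r f \<longleftrightarrow>
    (\<forall>j\<in>{1..r}. \<forall>t\<in>carrier G. f j t \<in> {0..1}) \<and>
    (\<forall>t\<in>carrier G. (\<Sum>j\<in>{1..r}. f j t) = 1)"

definition mono_proportion ::
    "('a, 'b) monoid_scheme \<Rightarrow> nat \<Rightarrow> (nat \<Rightarrow> int) \<Rightarrow> nat \<Rightarrow> (nat \<Rightarrow> 'a \<Rightarrow> real) \<Rightarrow> real"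
  where "mono_proportion G k a r f =
    1 / real (card (solutions G k a)) *
      (\<Sum>v\<in>solutions G k a. \<Sum>j\<in>{1..r}. \<Prod>i\<in>{1..k}. f j (v i))"

definition common :: "('a, 'b) monoid_scheme \<Rightarrow> nat \<Rightarrow> (nat \<Rightarrow> int) \<Rightarrow> nat \<Rightarrow> bool"
  where "common G k a r \<longleftrightarrow>
    (\<forall>f. coloring G r f \<longrightarrow> mono_proportion G k a r f \<ge> real r powi (1 - int k))"

definition uncommon :: "('a, 'b) monoid_scheme \<Rightarrow> nat \<Rightarrow> (nat \<Rightarrow> int) \<Rightarrow> nat \<Rightarrow> bool"
  where "uncommon G k a r \<longleftrightarrow> \<not> common G k a r"

end

theory Submission
  imports Defs "HOL-Algebra.Multiplicative_Group"
begin

text \<open>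
  Perturb the uniform coloring by multiples \<open>\<beta>\<^sub>j\<close> of the mean-zero function
  \<open>\<delta>\<^sub>0 - 1 / |G|\<close>. Any \<open>k - 1\<close> coordinates of a random solution are independent and
  uniform, so in the expansion of the product all mixed terms vanish and
  \<open>\<mu> = r\<^bsup>1-k\<^esup> + c (\<Sum>\<^sub>j \<beta>\<^sub>j\<^bsup>k\<^esup>)\<close> with \<open>c > 0\<close>. For odd \<open>k \<ge> 3\<close>, the weights
  \<open>(\<epsilon>, \<epsilon>, -2 \<epsilon>, 0, \<dots>, 0)\<close> have sum zero and negative sum of \<open>k\<close>-th powers.
\<close>

text \<open>By Bezout \<open>u\<close> inverts \<open>a\<close> modulo the group order, and
  exponents matter only modulo the order. So the \<open>a\<close>-th power map is a bijection with
  inverse the \<open>u\<close>-th power map, and a coordinate can be solved for in an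
  equation.\<close>

lemma (in group) int_pow_coprime_order_inverse:
  assumes "finite (carrier G)" "coprime (int (order G)) a"
  obtains u :: int where
    "\<And>x t. x \<in> carrier G \<Longrightarrow> t \<in> carrier G \<Longrightarrow> x [^] a = t \<longleftrightarrow> x = t [^] u"
proof -
  obtain p u where pu: "p * int (order G) + u * a = 1"
    using assms(2) by (metis bezout_int coprime_iff_gcd_eq_1)
  have cancel: "x [^] (u * a) = x" if x: "x \<in> carrier G" for x
  proof -
    have "x [^] (int (order G) * p) = \<one>"
      using x pow_order_eq_1[OF x] by (simp add: int_pow_pow[symmetric] int_pow_int)
    then have "x = x [^] (p * int (order G) + u * a)"
      using pu x by simp
    also have "\<dots> = x [^] (u * a)"
      using x \<open>x [^] (int (order G) * p) = \<one>\<close> by (simp add: int_pow_mult mult.commute)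
    finally show ?thesis by simp
  qed
  show thesis
  proof (rule that)
    fix x t assume "x \<in> carrier G" "t \<in> carrier G"
    then show "x [^] a = t \<longleftrightarrow> x = t [^] u"
      using cancel by (auto simp: int_pow_pow mult.commute)
  qed
qed

text \<open>
  As a function of the right-hand side \<open>t\<close>, the weighted number of solutions is the convolution
  of functions of the form \<open>A + B \<delta>\<close>, and this form is preserved.
\<close>

lemma (in comm_group) weighted_solution_sum:
  fixes \<alpha> \<beta> :: real and a :: "'i \<Rightarrow> int"
  assumes fin: "finite (carrier G)" and "finite I"
    and "\<forall>i\<in>I. coprime (int (order G)) (a i)" and "t \<in> carrier G"
  shows "(\<Sum>v\<in>I \<rightarrow>\<^sub>E carrier G. of_bool ((\<Otimes>i\<in>I. v i [^] a i) = t) *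
            (\<Prod>i\<in>I. \<alpha> + \<beta> * of_bool (v i = \<one>))) =
    ((\<alpha> * real (order G) + \<beta>) ^ card I - \<beta> ^ card I) / real (order G) +
      \<beta> ^ card I * of_bool (t = \<one>)"
  using assms(2-4)
proof (induction I arbitrary: t rule: finite_induct)
  case empty
  then show ?case by (auto simp: of_bool_def)
next
  case (insert j I)
  define n where "n = real (order G)"
  have n: "n > 0" "real (card (carrier G)) = n"
    using order_gt_0_iff_finite fin by (auto simp: n_def order_def)
  \<comment> \<open>By the induction hypothesis, the sum over \<open>I\<close> with right-hand side
    \<open>s\<close> is \<open>A + B * of_bool (s = \<one>)\<close>.\<close>
  define A B where "A = ((\<alpha> * n + \<beta>) ^ card I - \<beta> ^ card I) / n" and "B = \<beta> ^ card I"
  let ?F = "\<lambda>I v. \<Prod>i\<in>I. \<alpha> + \<beta> * of_bool (v i = \<one>)"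
  obtain u :: int where u:
    "\<And>x t. x \<in> carrier G \<Longrightarrow> t \<in> carrier G \<Longrightarrow> x [^] a j = t \<longleftrightarrow> x = t [^] u"
    using int_pow_coprime_order_inverse[OF fin] insert.prems(1) by blast
  \<comment> \<open>With coordinate \<open>j\<close> fixed to \<open>x\<close>, the others must
    multiply to \<open>?s\<close>, and \<open>?s = \<one>\<close> means that \<open>x\<close> is the
    unique \<open>a j\<close>-th root \<open>t [^] u\<close> of \<open>t\<close>.\<close>
  have step: "(\<Sum>v\<in>I \<rightarrow>\<^sub>E carrier G.
        of_bool ((\<Otimes>i\<in>insert j I. (v(j := x)) i [^] a i) = t) * ?F (insert j I) (v(j := x))) =
      (\<alpha> + \<beta> * of_bool (x = \<one>)) * (A + B * of_bool (x = t [^] u))"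
    if x: "x \<in> carrier G" for x
  proof -
    let ?s = "inv (x [^] a j) \<otimes> t"
    have eq: "of_bool ((\<Otimes>i\<in>insert j I. (v(j := x)) i [^] a i) = t) * ?F (insert j I) (v(j := x)) =
        (\<alpha> + \<beta> * of_bool (x = \<one>)) * (of_bool ((\<Otimes>i\<in>I. v i [^] a i) = ?s) * ?F I v)"
      if v: "v \<in> I \<rightarrow>\<^sub>E carrier G" for v
    proof -
      have vc: "v i \<in> carrier G" if "i \<in> I" for i
        using v that by auto
      have c: "(\<Otimes>i\<in>I. (v(j := x)) i [^] a i) = (\<Otimes>i\<in>I. v i [^] a i)"
        using insert.hyps vc by (intro finprod_cong'[OF refl]) auto
      have "(\<Otimes>i\<in>insert j I. (v(j := x)) i [^] a i) = x [^] a j \<otimes> (\<Otimes>i\<in>I. v i [^] a i)"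
        using insert.hyps vc x by (subst finprod_insert) (auto simp: c[unfolded fun_upd_apply])
      moreover have "(\<Otimes>i\<in>I. v i [^] a i) \<in> carrier G"
        using vc by (intro finprod_closed) auto
      ultimately have "(\<Otimes>i\<in>insert j I. (v(j := x)) i [^] a i) = t \<longleftrightarrow>
          (\<Otimes>i\<in>I. v i [^] a i) = ?s"
        using x insert.prems(2) inv_solve_left[of "\<Otimes>i\<in>I. v i [^] a i" "x [^] a j" t]
        by (simp only: int_pow_closed) (rule eq_commute)
      moreover have "?F I (v(j := x)) = ?F I v"
        using insert.hyps by (intro prod.cong) auto
      ultimately show ?thesis
        using insert.hyps by (simp del: fun_upd_apply) simp
    qed
    have s: "?s = \<one> \<longleftrightarrow> x = t [^] u"
      using x insert.prems(2) u[of x t] inv_solve_left[of \<one> "x [^] a j" t] by auto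
    have "(\<Sum>v\<in>I \<rightarrow>\<^sub>E carrier G. of_bool ((\<Otimes>i\<in>I. v i [^] a i) = ?s) * ?F I v) =
        A + B * of_bool (?s = \<one>)"
      using insert.IH[of ?s] insert.prems x by (simp add: A_def B_def n_def)
    then show ?thesis
      by (simp only: eq sum_distrib_left[symmetric] s cong: sum.cong)
  qed
  have tu: "t [^] u \<in> carrier G" "t [^] u = \<one> \<longleftrightarrow> t = \<one>"
    using insert.prems(2) u[of \<one> t] by auto
  have "(\<Sum>v\<in>insert j I \<rightarrow>\<^sub>E carrier G. of_bool ((\<Otimes>i\<in>insert j I. v i [^] a i) = t) * ?F (insert j I) v) =
      (\<Sum>(x, v)\<in>carrier G \<times> (I \<rightarrow>\<^sub>E carrier G).
        of_bool ((\<Otimes>i\<in>insert j I. (v(j := x)) i [^] a i) = t) * ?F (insert j I) (v(j := x)))"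
    unfolding PiE_insert_eq
    by (subst sum.reindex[OF inj_combinator[OF insert.hyps(2)]])
       (simp only: o_def case_prod_unfold)
  also have "\<dots> = (\<Sum>x\<in>carrier G. (\<alpha> + \<beta> * of_bool (x = \<one>)) * (A + B * of_bool (x = t [^] u)))"
    by (simp only: sum.cartesian_product[symmetric] step cong: sum.cong)
  \<comment> \<open>The two indicators hold at a common \<open>x\<close> only if
    \<open>t [^] u = \<one>\<close>, that is, \<open>t = \<one>\<close>; this cross term is the new
    delta part.\<close>
  also have "\<dots> = (\<Sum>x\<in>carrier G. \<alpha> * A + (if x = \<one> then \<beta> * A else 0) +
      (if x = t [^] u then \<alpha> * B else 0) + (if x = \<one> then \<beta> * B * of_bool (t = \<one>) else 0))"
    using tu(2) by (intro sum.cong) (auto simp: algebra_simps)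
  also have "\<dots> = n * (\<alpha> * A) + \<beta> * A + \<alpha> * B + \<beta> * B * of_bool (t = \<one>)"
    using fin tu(1) n(2) by (simp add: sum.distrib)
  \<comment> \<open>The constant part is \<open>(\<alpha> * n + \<beta>) * A + \<alpha> * B\<close>,
    which telescopes to the next difference of powers over \<open>n\<close>.\<close>
  also have "\<dots> = ((\<alpha> * n + \<beta>) ^ card (insert j I) - \<beta> ^ card (insert j I)) / n +
      \<beta> ^ card (insert j I) * of_bool (t = \<one>)"
    using insert.hyps n(1) by (simp add: A_def B_def field_simps)
  finally show ?case by (simp only: n_def)
qed

lemma (in comm_group) solutions_weighted_sum:
  fixes \<alpha> \<beta> :: real
  assumes fin: "finite (carrier G)" and "\<forall>i\<in>{1..k}. coprime (int (order G)) (a i)"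
  shows "(\<Sum>v\<in>solutions G k a. \<Prod>i\<in>{1..k}. \<alpha> + \<beta> * of_bool (v i = \<one>)) =
    ((\<alpha> * real (order G) + \<beta>) ^ k - \<beta> ^ k) / real (order G) + \<beta> ^ k"
proof -
  have "finite ({1..k} \<rightarrow>\<^sub>E carrier G)"
    using fin by (intro finite_PiE) auto
  then have "(\<Sum>v\<in>solutions G k a. \<Prod>i\<in>{1..k}. \<alpha> + \<beta> * of_bool (v i = \<one>)) =
      (\<Sum>v\<in>{1..k} \<rightarrow>\<^sub>E carrier G. of_bool ((\<Otimes>i\<in>{1..k}. v i [^] a i) = \<one>) *
            (\<Prod>i\<in>{1..k}. \<alpha> + \<beta> * of_bool (v i = \<one>)))"
    unfolding solutions_def by (intro sum.mono_neutral_cong_left) auto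
  then show ?thesis
    using weighted_solution_sum[OF fin _ assms(2) one_closed, of \<alpha> \<beta>] by simp
qed

text \<open>Counting is the case of constant weight 1; \<open>k > 0\<close> makes the terms
  \<open>0 ^ k\<close> vanish.\<close>

lemma (in comm_group) card_solutions:
  assumes "finite (carrier G)" "\<forall>i\<in>{1..k}. coprime (int (order G)) (a i)" "k > 0"
  shows "real (card (solutions G k a)) = real (order G) ^ k / real (order G)"
  using solutions_weighted_sum[OF assms(1,2), of 1 0] assms(3) by (simp add: power_0_left)

text \<open>Subtracting \<open>\<beta> j / real (order G)\<close> keeps the total of each color over
  the group at \<open>real (order G) / real r\<close>. Hence the first power in
  \<open>solutions_weighted_sum\<close> is the same for all colors, and \<open>\<beta> j\<close>
  enters only through its \<open>k\<close>-th power.\<close>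

lemma (in comm_group) mono_proportion_perturbed:
  fixes \<beta> :: "nat \<Rightarrow> real"
  assumes fin: "finite (carrier G)" and cop: "\<forall>i\<in>{1..k}. coprime (int (order G)) (a i)"
    and "k > 0" "r > 0"
  shows "mono_proportion G k a r
      (\<lambda>j t. (1 / real r - \<beta> j / real (order G)) + \<beta> j * of_bool (t = \<one>)) =
    real r powi (1 - int k) +
      (real (order G) - 1) / real (order G) ^ k * (\<Sum>j\<in>{1..r}. \<beta> j ^ k)"
proof -
  define n where "n = real (order G)"
  have n: "n > 0"
    using order_gt_0_iff_finite fin by (auto simp: n_def)
  have "(\<Sum>v\<in>solutions G k a. \<Sum>j\<in>{1..r}. \<Prod>i\<in>{1..k}.
        (1 / real r - \<beta> j / n) + \<beta> j * of_bool (v i = \<one>)) =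
      (\<Sum>j\<in>{1..r}. ((n / real r) ^ k - \<beta> j ^ k) / n + \<beta> j ^ k)"
    using n by (subst sum.swap, subst solutions_weighted_sum[OF fin cop])
      (simp add: n_def[symmetric] left_diff_distrib)
  \<comment> \<open>The factor pulled out is the number of solutions, which the normalization
    cancels.\<close>
  also have "\<dots> = (\<Sum>j\<in>{1..r}. n ^ k / n * (1 / real r ^ k + (n - 1) / n ^ k * \<beta> j ^ k))"
    using n by (intro sum.cong) (auto simp: field_simps power_divide)
  also have "\<dots> = n ^ k / n * (real r / real r ^ k + (n - 1) / n ^ k * (\<Sum>j\<in>{1..r}. \<beta> j ^ k))"
    by (simp only: sum.distrib sum_distrib_left[symmetric]) simp
  finally show ?thesis
    using n assms(3,4) card_solutions[OF fin cop]
    by (simp add: mono_proportion_def n_def[symmetric] power_int_diff)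
qed

text \<open>Each value is \<open>1 / r\<close> plus \<open>\<beta> j\<close> times a number of
  absolute value at most 1, so it lies between 0 and \<open>2 / r\<close>, which is at most
  1.\<close>

lemma coloring_perturbed:
  fixes \<beta> :: "nat \<Rightarrow> real"
  assumes "order G > 0" "r \<ge> 2" "\<And>j. \<bar>\<beta> j\<bar> \<le> 1 / real r" "(\<Sum>j\<in>{1..r}. \<beta> j) = 0"
  shows "coloring G r (\<lambda>j t. (1 / real r - \<beta> j / real (order G)) + \<beta> j * of_bool (t = \<one>\<^bsub>G\<^esub>))"
proof -
  have "(1 / real r - \<beta> j / real (order G)) + \<beta> j * of_bool P \<in> {0..1}" for j P
  proof -
    have "\<bar>of_bool P - 1 / real (order G)\<bar> \<le> 1"
      using assms(1) by (cases P) (auto simp: field_simps)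
    then have "\<bar>\<beta> j * (of_bool P - 1 / real (order G))\<bar> \<le> 1 / real r * 1"
      unfolding abs_mult using assms(3) by (intro mult_mono) auto
    moreover have "2 * (1 / real r) \<le> 1"
      using assms(2) by (simp add: field_simps)
    ultimately show ?thesis
      by (auto simp: abs_le_iff algebra_simps)
  qed
  moreover have "(\<Sum>j\<in>{1..r}. (1 / real r - \<beta> j / real (order G)) + \<beta> j * of_bool P) = 1" for P
    using assms(2,4)
    by (simp add: sum.distrib sum_subtractf sum_divide_distrib[symmetric] sum_distrib_right[symmetric])
  ultimately show ?thesis
    by (simp add: coloring_def)
qed

theorem theorem1p1:
  fixes G :: "('a, 'b) monoid_scheme"
    and m r :: nat
    and a :: "nat \<Rightarrow> int"
  assumes "comm_group G"
    and "finite (carrier G)"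
    and "carrier G \<noteq> {\<one>\<^bsub>G\<^esub>}"
    and "m \<ge> 1"
    and "\<forall>i\<in>{1..2 * m + 1}. a i \<noteq> 0"
    and "\<forall>i\<in>{1..2 * m + 1}. coprime (int (order G)) (a i)"
    and "r \<ge> 3"
  shows "uncommon G (2 * m + 1) a r"
proof -
  interpret comm_group G by fact
  define k where "k = 2 * m + 1"
  \<comment> \<open>The scale \<open>1 / (2 * r)\<close> is the largest for which the doubled
    negative weight still meets the bound \<open>1 / r\<close> of
    \<open>coloring_perturbed\<close>.\<close>
  define \<beta> :: "nat \<Rightarrow> real" where
    "\<beta> j = (if j \<in> {1, 2} then 1 / (2 * real r) else if j = 3 then - 1 / real r else 0)" for j
  let ?f = "\<lambda>j t. (1 / real r - \<beta> j / real (order G)) + \<beta> j * of_bool (t = \<one>\<^bsub>G\<^esub>)"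
  have sum3: "(\<Sum>j\<in>{1..r}. h j) = h 1 + h 2 + h 3" if "\<And>j. j > 3 \<Longrightarrow> h j = 0" for h :: "nat \<Rightarrow> real"
  proof -
    have "(\<Sum>j\<in>{1..r}. h j) = (\<Sum>j\<in>{1, 2, 3}. h j)"
      using \<open>r \<ge> 3\<close> that by (intro sum.mono_neutral_right) auto
    then show ?thesis by simp
  qed
  \<comment> \<open>Nontriviality makes the factor \<open>order G - 1\<close> in front of the power
    sum strictly positive.\<close>
  have ord: "order G > 1"
  proof -
    have "order G \<noteq> 1"
      using assms(3) one_closed by (metis order_def card_1_singletonE singletonD)
    moreover have "order G > 0"
      using order_gt_0_iff_finite assms(2) by simp
    ultimately show ?thesis by simp
  qed
  have col: "coloring G r ?f"
    proof (rule coloring_perturbed)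
    show "\<bar>\<beta> j\<bar> \<le> 1 / real r" for j
      by (simp add: \<beta>_def divide_simps)
    show "(\<Sum>j\<in>{1..r}. \<beta> j) = 0"
      by (subst sum3) (auto simp: \<beta>_def)
  qed (use ord \<open>r \<ge> 3\<close> in auto)
  \<comment> \<open>Odd \<open>k\<close> preserves the sign of the third weight, and
    \<open>k > 1\<close> lets it outweigh the two positive ones, since
    \<open>2 / 2 ^ k < 1\<close>.\<close>
  have "(- 1 / real r) ^ k = - (1 / real r ^ k)"
    by (simp add: k_def power_divide)
  then have "(\<Sum>j\<in>{1..r}. \<beta> j ^ k) = (2 / 2 ^ k - 1) / real r ^ k"
    by (subst sum3) (auto simp: \<beta>_def power_divide power_mult_distrib diff_divide_distrib k_def)
  moreover have "(2::real) ^ k > 2 ^ 1"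
    using \<open>m \<ge> 1\<close> by (intro power_strict_increasing) (auto simp: k_def)
  ultimately have "(\<Sum>j\<in>{1..r}. \<beta> j ^ k) < 0"
    using \<open>r \<ge> 3\<close> by (simp add: divide_neg_pos)
  then have "(real (order G) - 1) / real (order G) ^ k * (\<Sum>j\<in>{1..r}. \<beta> j ^ k) < 0"
    using ord by (intro mult_pos_neg) auto
  moreover have "mono_proportion G k a r ?f = real r powi (1 - int k) +
      (real (order G) - 1) / real (order G) ^ k * (\<Sum>j\<in>{1..r}. \<beta> j ^ k)"
    using assms(2,6,7) by (intro mono_proportion_perturbed) (auto simp: k_def)
  ultimately have "mono_proportion G k a r ?f < real r powi (1 - int k)"
    by linarith
  with col show ?thesis
    unfolding uncommon_def common_def k_def[symmetric] using not_le by blast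
qed

end
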